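(* Let $n\geq 1$ and let $i$ be an integer with $\lceil n/3\rceil\leq i\leq \lfloor n/2\rfloor$. Then $$d_a(P_n,i)\leq d_a(P_{n-2},i-1)+d_a(P_{n-3},i-1)+d_a(P_{n-4},i-2)+\sum_{k=3}^{i} d(P_{n-k},i-k+1)+\sum_{k=5}^{i+1} d(P_{n-k},i-k+2).$$
   Context: $P_m$ denotes the path on $m$ vertices. A dominating set of a graph $G=(V,E)$ is a set $D\subseteq V$ such that every vertex not in $D$ is adjacent to some vertex of $D$. A dominating set $D$ is accurate if no $|D|$-element subset of $V\setminus D$ is a dominating set of $G$. $d(G,j)$ is the number of dominating sets of $G$ of cardinality $j$ and $d_a(G,j)$ the number of accurate dominating sets of $G$ of cardinality $j$. Empty sums are $0$.
   Formalization: Here d_a(P_0,0) is taken to be 1 by convention (the literal definition gives 0, and the inequality would then fail at n=3, i=1), and d_a and d are taken to be 0 when the path index or the cardinality is negative. *)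

theory Defs
  imports Complex_Main
begin

text \<open>A simple graph is a pair of a vertex set and a set of two-element edges.\<close>

type_synonym 'a sgraph = "'a set \<times> 'a set set"

abbreviation verts :: "'a sgraph \<Rightarrow> 'a set" where
  "verts G \<equiv> fst G"

abbreviation edges :: "'a sgraph \<Rightarrow> 'a set set" where
  "edges G \<equiv> snd G"

definition dominating_set :: "'a sgraph \<Rightarrow> 'a set \<Rightarrow> bool" where
  "dominating_set G D \<longleftrightarrow>
     D \<subseteq> verts G \<and> (\<forall>v \<in> verts G - D. \<exists>u \<in> D. {u, v} \<in> edges G)"

definition accurate_dominating_set :: "'a sgraph \<Rightarrow> 'a set \<Rightarrow> bool" where
  "accurate_dominating_set G D \<longleftrightarrow>
     dominating_set G D \<and>
     \<not> (\<exists>S. S \<subseteq> verts G - D \<and> card S = card D \<and> dominating_set G S)"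

definition num_dominating :: "'a sgraph \<Rightarrow> nat \<Rightarrow> nat" where
  "num_dominating G j = card {D. dominating_set G D \<and> card D = j}"

definition num_accurate_dominating :: "'a sgraph \<Rightarrow> nat \<Rightarrow> nat" where
  "num_accurate_dominating G j = card {D. accurate_dominating_set G D \<and> card D = j}"

definition path_graph :: "nat \<Rightarrow> nat sgraph" where
  "path_graph m = ({..<m}, {{k, Suc k} | k. Suc k < m})"

text \<open>
  The counts for paths take integer arguments, since index and cardinality are shifted downwards
  and may leave the range where they denote a path and a set size. The value is 0 if the index
  or the cardinality is negative. For the path without vertices both counts are 1 at
  cardinality 0 and 0 elsewhere. For \<open>d_path\<close> this is what the definition gives. For
  \<open>da_path\<close> it is a convention: read literally, the empty set would be a dominating set of the
  empty graph contained in its own complement, hence not accurate, and the inequality for \<open>d\<^sub>a\<close>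
  on paths would fail for the single pair of three vertices and cardinality one.
\<close>

definition d_path :: "int \<Rightarrow> int \<Rightarrow> nat" where
  "d_path m j = (if m < 0 \<or> j < 0 then 0 else num_dominating (path_graph (nat m)) (nat j))"

definition da_path :: "int \<Rightarrow> int \<Rightarrow> nat" where
  "da_path m j =
     (if m < 0 \<or> j < 0 then 0
      else if m = 0 then (if j = 0 then 1 else 0)
      else num_accurate_dominating (path_graph (nat m)) (nat j))"

end

theory Submission
  imports Defs
begin

text \<open>
  Read a vertex set of a path as a 0-1 word. An accurate dominating set of size at most \<open>n / 2\<close>
  starts with \<open>10\<close>, \<open>010\<close>, \<open>0110\<close>, or a longer run of ones, and the words of the last kind are
  counted by the two sums. Removing the prefix preserves accuracy for \<open>10w\<close> and \<open>0110w\<close>,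
  because a dominating set avoiding \<open>w\<close> extends by the zeros of the prefix. For \<open>010w\<close> this can
  fail, but only for words \<open>01010v\<close>; then \<open>010v\<close> is accurate while \<open>10010v\<close> is not, so
  \<open>010v\<close> is not the remainder of an accurate word \<open>10w\<close>, and the exceptional words fit in the
  term for \<open>n - 2\<close> as well.
\<close>

section \<open>Vertex sets of paths as words: cutting off a prefix and joining two words\<close>

definition tail :: "nat \<Rightarrow> nat set \<Rightarrow> nat set" where
  "tail k D = {x. k + x \<in> D}"

abbreviation dom_path :: "nat \<Rightarrow> nat set \<Rightarrow> bool" where
  "dom_path m \<equiv> dominating_set (path_graph m)"

abbreviation acc_path :: "nat \<Rightarrow> nat set \<Rightarrow> bool" where
  "acc_path m \<equiv> accurate_dominating_set (path_graph m)"

lemma edge_path_graph_iff: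
  "{u, v} \<in> edges (path_graph m) \<longleftrightarrow> u < m \<and> v < m \<and> (v = Suc u \<or> u = Suc v)"
  by (auto simp: path_graph_def doubleton_eq_iff)

lemma verts_path_graph [simp]: "verts (path_graph m) = {..<m}"
  by (simp add: path_graph_def)

lemma dom_path_iff:
  "dom_path m D \<longleftrightarrow>
     D \<subseteq> {..<m} \<and> (\<forall>v<m. v \<in> D \<or> Suc v \<in> D \<or> (\<exists>u. v = Suc u \<and> u \<in> D))"
  unfolding dominating_set_def edge_path_graph_iff verts_path_graph
  by (auto simp: subset_iff) blast+

lemma dom_pathD:
  assumes "dom_path m D" "v < m"
  shows "v \<in> D \<or> Suc v \<in> D \<or> (\<exists>u. v = Suc u \<and> u \<in> D)"
  using assms by (auto simp: dom_path_iff)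

lemma dom_path_subset: "dom_path m D \<Longrightarrow> D \<subseteq> {..<m}"
  by (simp add: dom_path_iff)

lemma dom_path_finite: "dom_path m D \<Longrightarrow> finite D"
  using dom_path_subset finite_subset by blast

lemma acc_path_dom: "acc_path m D \<Longrightarrow> dom_path m D"
  by (simp add: accurate_dominating_set_def)

lemma mem_prefix_iff: "D \<inter> {..<k} = P \<Longrightarrow> x < k \<Longrightarrow> x \<in> D \<longleftrightarrow> x \<in> P"
  by blast

lemma split_tail: "D = (D \<inter> {..<k}) \<union> (+) k ` tail k D"
proof -
  have "x \<in> (+) k ` tail k D" if "x \<in> D" "\<not> x < k" for x
    using that by (intro image_eqI[of _ _ "x - k"]) (auto simp: tail_def)
  then show ?thesis by (auto simp: tail_def)
qed

lemma card_split_tail: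
  assumes "finite D"
  shows "card D = card (D \<inter> {..<k}) + card (tail k D)"
proof -
  have "(D \<inter> {..<k}) \<inter> (+) k ` tail k D = {}" by auto
  moreover have "finite ((+) k ` tail k D)"
    using assms by (rule rev_finite_subset) (auto simp: tail_def)
  ultimately have "card ((D \<inter> {..<k}) \<union> (+) k ` tail k D)
      = card (D \<inter> {..<k}) + card ((+) k ` tail k D)"
    using assms by (intro card_Un_disjoint) auto
  then show ?thesis
    using split_tail[of D k] by (simp add: card_image)
qed

lemma inj_on_tail: "inj_on (tail k) {D. D \<inter> {..<k} = P}"
  by (rule inj_onI) (metis (mono_tags, lifting) mem_Collect_eq split_tail)

text \<open>Cutting deletes only the edge between \<open>k - 1\<close> and \<open>k\<close>, so
  \<open>k\<close> is the only remaining vertex that could lose its dominator. The last assumption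
  prevents this: \<open>k\<close> is chosen, has its right neighbour chosen, or had no help from the
  left.\<close>

lemma dom_path_tail:
  assumes "dom_path n D" and "k \<le> n" and "k \<in> D \<or> Suc k \<in> D \<or> k - 1 \<notin> D"
  shows "dom_path (n - k) (tail k D)"
  unfolding dom_path_iff
proof (intro conjI allI impI)
  show "tail k D \<subseteq> {..<n - k}"
    using dom_path_subset[OF assms(1)] by (fastforce simp: tail_def)
next
  fix v assume "v < n - k"
  then have "k + v < n" by simp
  from dom_pathD[OF assms(1) this]
  show "v \<in> tail k D \<or> Suc v \<in> tail k D \<or> (\<exists>u. v = Suc u \<and> u \<in> tail k D)"
    using assms(3) by (cases v) (auto simp: tail_def)
qed

lemma dom_path_join:
  assumes "dom_path k T" and "dom_path (n - k) S" and "k \<le> n"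
  shows "dom_path n (T \<union> (+) k ` S)"
  unfolding dom_path_iff
proof (intro conjI allI impI)
  show "T \<union> (+) k ` S \<subseteq> {..<n}"
    using dom_path_subset[OF assms(1)] dom_path_subset[OF assms(2)] assms(3) by fastforce
next
  fix v assume v: "v < n"
  let ?U = "T \<union> (+) k ` S"
  show "v \<in> ?U \<or> Suc v \<in> ?U \<or> (\<exists>u. v = Suc u \<and> u \<in> ?U)"
  proof (cases "v < k")
    case True
    then show ?thesis using dom_pathD[OF assms(1), of v] by auto
  next
    case False
    then obtain w where w: "v = k + w" by (metis le_add_diff_inverse not_less)
    then have "w < n - k" using v by simp
    from dom_pathD[OF assms(2) this] consider
      "w \<in> S" | "Suc w \<in> S" | u where "w = Suc u" "u \<in> S" by blast
    then show ?thesis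
    proof cases
      case 2
      then have "Suc v \<in> (+) k ` S" by (intro image_eqI[of _ _ "Suc w"]) (auto simp: w)
      then show ?thesis by blast
    qed (auto simp: w)
  qed
qed

lemma card_join:
  assumes "dom_path k T" and "finite S"
  shows "card (T \<union> (+) k ` S) = card T + card S"
proof -
  have "T \<inter> (+) k ` S = {}" using dom_path_subset[OF assms(1)] by auto
  then show ?thesis
    using assms dom_path_finite by (simp add: card_Un_disjoint card_image)
qed

text \<open>Call a dominating set of the same size in the complement a rival. A rival of
  \<open>D\<close> is assembled here from two pieces of the path, as the edge between the pieces can
  only help. Every later refutation of accuracy goes through this lemma.\<close>

lemma not_acc_path_join:
  assumes "dom_path k T" and "dom_path (n - k) S" and "k \<le> n"
    and "T \<inter> D = {}" and "S \<inter> tail k D = {}" and "card T + card S = card D"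
  shows "\<not> acc_path n D"
proof -
  let ?U = "T \<union> (+) k ` S"
  have "dom_path n ?U" by (rule dom_path_join[OF assms(1-3)])
  moreover from this have "?U \<subseteq> verts (path_graph n) - D"
    using assms(4,5) dom_path_subset by (fastforce simp: tail_def)
  moreover have "card ?U = card D"
    using card_join[OF assms(1) dom_path_finite[OF assms(2)]] assms(6) by simp
  ultimately show ?thesis unfolding accurate_dominating_set_def by blast
qed

text \<open>A rival of \<open>tail k D\<close>, placed behind \<open>T\<close>, would be a rival of
  \<open>D\<close>: the set \<open>T\<close> lies in the zeros of the prefix and has as many
  elements as the prefix has ones.\<close>

lemma acc_path_tail:
  assumes "acc_path n D" and "k \<le> n" and "k \<in> D \<or> Suc k \<in> D \<or> k - 1 \<notin> D"
    and "dom_path k T" and "T \<inter> D = {}" and "card T = card (D \<inter> {..<k})"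
  shows "acc_path (n - k) (tail k D)"
proof (rule ccontr)
  assume not_acc: "\<not> ?thesis"
  have D: "dom_path n D" using assms(1) by (rule acc_path_dom)
  have "dom_path (n - k) (tail k D)" using dom_path_tail[OF D assms(2,3)] .
  with not_acc obtain S where "S \<inter> tail k D = {}" "card S = card (tail k D)" "dom_path (n - k) S"
    unfolding accurate_dominating_set_def by blast
  then show False
    using not_acc_path_join[OF assms(4) _ assms(2) assms(5), of S] assms(1,6)
      card_split_tail[OF dom_path_finite[OF D], of k] by simp
qed

text \<open>The new first vertex is dominated by the shifted vertex \<open>0\<close> of
  \<open>S\<close>.\<close>

lemma dom_path_Suc_image:
  assumes "dom_path m S" and "0 \<in> S"
  shows "dom_path (Suc m) (Suc ` S)"
  unfolding dom_path_iff
proof (intro conjI allI impI)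
  show "Suc ` S \<subseteq> {..<Suc m}" using dom_path_subset[OF assms(1)] by auto
next
  fix v assume "v < Suc m"
  then show "v \<in> Suc ` S \<or> Suc v \<in> Suc ` S \<or> (\<exists>u. v = Suc u \<and> u \<in> Suc ` S)"
    using assms(2) dom_pathD[OF assms(1), of "v - 1"] by (cases v) auto
qed

text \<open>Initial pieces of rivals: on two vertices \<open>{0}\<close> avoids the prefix
  \<open>01\<close> and \<open>{Suc 0}\<close> avoids \<open>10\<close>; on three vertices
  \<open>{Suc 0}\<close> avoids \<open>100\<close>; on four vertices \<open>{0, 3}\<close> avoids
  \<open>0110\<close>.\<close>

lemma dom_path_small:
  "dom_path 2 {0}" "dom_path 2 {Suc 0}" "dom_path 3 {Suc 0}" "dom_path 4 {0, 3}"
  by (auto simp: dom_path_iff less_Suc_eq numeral_eq_Suc)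

section \<open>Counting sets with a prescribed prefix\<close>

text \<open>The empty set counts as accurate on the path without vertices, as in \<open>da_path\<close>.\<close>

definition acc_sets :: "nat \<Rightarrow> nat \<Rightarrow> nat set set" where
  "acc_sets m j = {D. (acc_path m D \<or> m = 0 \<and> D = {}) \<and> card D = j}"

lemma finite_dom_sets: "finite {D. dom_path m D \<and> card D = j}"
  by (rule finite_subset[of _ "Pow {..<m}"]) (auto dest: dom_path_subset)

lemma finite_acc_sets: "finite (acc_sets m j)"
  by (rule finite_subset[of _ "Pow {..<m}"])
    (auto simp: acc_sets_def dest!: acc_path_dom dom_path_subset)

lemma da_path_eq_card: "da_path (int m) (int j) = card (acc_sets m j)"
proof (cases "m = 0")
  case True
  have "D = {}" if "acc_path 0 D" for D
    using dom_path_subset[OF acc_path_dom[OF that]] by simp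
  then have "acc_sets 0 j = (if j = 0 then {{}} else {})"
    by (auto simp: acc_sets_def dest: \<open>\<And>D. acc_path 0 D \<Longrightarrow> D = {}\<close>)
  then show ?thesis using True by (simp add: da_path_def)
next
  case False
  then show ?thesis by (simp add: da_path_def acc_sets_def num_accurate_dominating_def)
qed

lemma da_path_eq_card_diff:
  "a \<le> n \<Longrightarrow> b \<le> i \<Longrightarrow> da_path (int n - int a) (int i - int b) = card (acc_sets (n - a) (i - b))"
  using da_path_eq_card[of "n - a" "i - b"] by (simp only: of_nat_diff)

text \<open>Serves the long runs of ones, where only domination of the remainder is kept. A prefix
  ending in zero gives the remainder no help, so the remainder dominates by itself, and the fixed
  prefix makes its removal injective.\<close>

lemma card_prefix_le_num_dominating:
  assumes "k \<le> n" and "k - 1 \<notin> P" and "\<X> \<subseteq> {D. dom_path n D \<and> card D = i \<and> D \<inter> {..<k} = P}"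
    and "0 < k"
  shows "card \<X> \<le> num_dominating (path_graph (n - k)) (i - card P)"
  unfolding num_dominating_def
proof (rule card_inj_on_le[OF _ _ finite_dom_sets])
  show "inj_on (tail k) \<X>"
    using assms(3) by (intro inj_on_subset[OF inj_on_tail[of k P]]) auto
  show "tail k ` \<X> \<subseteq> {D. dom_path (n - k) D \<and> card D = i - card P}"
  proof (rule image_subsetI)
    fix D assume "D \<in> \<X>"
    then have D: "dom_path n D" "card D = i" "D \<inter> {..<k} = P" using assms(3) by auto
    then have "k - 1 \<notin> D" using assms(2,4) by auto
    then show "tail k D \<in> {D. dom_path (n - k) D \<and> card D = i - card P}"
      using dom_path_tail[OF D(1) assms(1)] card_split_tail[OF dom_path_finite[OF D(1)], of k] D
      by auto
  qed
qed

lemma card_acc_prefix_le: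
  assumes "k \<le> n" and "k - 1 \<notin> P" and "0 < k"
    and "dom_path k T" and "T \<inter> P = {}" and "card T = card P"
  shows "card {D \<in> acc_sets n i. D \<inter> {..<k} = P} \<le> card (acc_sets (n - k) (i - card P))"
proof (rule card_inj_on_le[OF _ _ finite_acc_sets])
  show "inj_on (tail k) {D \<in> acc_sets n i. D \<inter> {..<k} = P}"
    by (intro inj_on_subset[OF inj_on_tail[of k P]]) auto
  show "tail k ` {D \<in> acc_sets n i. D \<inter> {..<k} = P} \<subseteq> acc_sets (n - k) (i - card P)"
  proof (rule image_subsetI)
    fix D assume "D \<in> {D \<in> acc_sets n i. D \<inter> {..<k} = P}"
    \<comment> \<open>Here \<open>n\<close> is positive, so the convention for the path without
      vertices does not interfere.\<close>
    then have D: "acc_path n D" "card D = i" "D \<inter> {..<k} = P"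
      using assms(1,3) by (auto simp: acc_sets_def)
    have "k - 1 \<notin> D" using D(3) assms(2,3) by auto
    moreover have "T \<inter> D = {}" using dom_path_subset[OF assms(4)] D(3) assms(5) by blast
    ultimately have "acc_path (n - k) (tail k D)"
      using acc_path_tail[OF D(1) assms(1) _ assms(4)] D(3) assms(6) by simp
    then show "tail k D \<in> acc_sets (n - k) (i - card P)"
      using card_split_tail[OF dom_path_finite[OF acc_path_dom[OF D(1)]], of k] D
      by (simp add: acc_sets_def)
  qed
qed

section \<open>The exceptional words\<close>

text \<open>The words \<open>010w\<close> with \<open>w\<close> not accurate.\<close>

locale exceptional =
  fixes n :: nat and D :: "nat set"
  assumes acc: "acc_path n D" and n: "3 \<le> n" and pre: "D \<inter> {..<3} = {1}"
    and tail: "tail 3 D \<notin> acc_sets (n - 3) (card D - 1)"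
begin

lemma prefix_mem: "0 \<notin> D" "Suc 0 \<in> D" "2 \<notin> D"
  using mem_prefix_iff[OF pre] by simp_all

lemma card_tails: "card D = Suc (card (tail 2 D))" "card D = Suc (card (tail 3 D))"
proof -
  have "D \<inter> {..<2} = {Suc 0}" using prefix_mem by (auto simp: less_2_cases_iff)
  then show "card D = Suc (card (tail 2 D))"
    using card_split_tail[OF dom_path_finite[OF acc_path_dom[OF acc]], of 2] by simp
  show "card D = Suc (card (tail 3 D))"
    using card_split_tail[OF dom_path_finite[OF acc_path_dom[OF acc]], of 3] pre by simp
qed

text \<open>Let \<open>S\<close> be a rival of the remainder \<open>w\<close> of
  \<open>010w\<close>. If \<open>S\<close> contained its first vertex, then \<open>S\<close> would
  also dominate the second zero of the prefix, and together with vertex \<open>0\<close> of the path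
  it would be a rival of \<open>D\<close>. So the first vertex of \<open>w\<close> must be dominated
  by the next one.\<close>

lemma dominating_complement:
  obtains S where "S \<inter> tail 3 D = {}" "dom_path (n - 3) S" "card S = card (tail 3 D)" "1 \<in> S"
proof -
  have dom: "dom_path (n - 3) (tail 3 D)"
    using dom_path_tail[OF acc_path_dom[OF acc] n] prefix_mem by simp
  \<comment> \<open>For \<open>n = 3\<close> the remainder is empty, and \<open>acc_sets\<close>
    counts it as accurate; this is where the convention matters.\<close>
  have ne: "n \<noteq> 3"
    using tail card_tails dom_path_subset[OF dom] by (auto simp: acc_sets_def)
  have "\<not> acc_path (n - 3) (tail 3 D)"
    using tail card_tails by (simp add: acc_sets_def)
  with dom obtain S where S: "S \<inter> tail 3 D = {}" "dom_path (n - 3) S" "card S = card (tail 3 D)"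
    unfolding accurate_dominating_set_def by blast
  have "0 \<notin> S"
  proof
    assume "0 \<in> S"
    then have "dom_path (n - 2) (Suc ` S)"
      using dom_path_Suc_image[OF S(2)] n by (simp add: numeral_eq_Suc Suc_diff_Suc)
    moreover have "Suc ` S \<inter> tail 2 D = {}"
      using S(1) by (auto simp: tail_def numeral_eq_Suc)
    ultimately show False
      using not_acc_path_join[OF dom_path_small(1), of n "Suc ` S" D] acc n prefix_mem S(3)
        card_tails by (simp add: card_image)
  qed
  then have "1 \<in> S"
    using dom_pathD[OF S(2), of 0] n ne by auto
  then show ?thesis using that S by blast
qed

text \<open>Since \<open>1\<close> lies in \<open>S\<close>, the second letter of \<open>w\<close>
  is zero, so \<open>w\<close> must dominate its first vertex by choosing it. Hence \<open>D\<close>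
  reads \<open>01010v\<close>, and after removal of \<open>01\<close> the new first vertex is still
  dominated from the right.\<close>

lemma acc_tail_2: "tail 2 D \<in> acc_sets (n - 2) (card D - 1)"
proof -
  obtain S where S: "S \<inter> tail 3 D = {}" "dom_path (n - 3) S" "1 \<in> S"
    using dominating_complement by metis
  have dom: "dom_path (n - 3) (tail 3 D)"
    using dom_path_tail[OF acc_path_dom[OF acc] n] prefix_mem by simp
  have "0 < n - 3" using dom_path_subset[OF S(2)] S(3) by auto
  then have "0 \<in> tail 3 D" using dom_pathD[OF dom] S(1,3) by fastforce
  then have "Suc 2 \<in> D" by (simp add: tail_def)
  moreover have "D \<inter> {..<2} = {Suc 0}" using prefix_mem by (auto simp: less_2_cases_iff)
  ultimately have "acc_path (n - 2) (tail 2 D)"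
    using acc_path_tail[OF acc _ _ dom_path_small(1)] n prefix_mem by simp
  then show ?thesis using card_tails by (simp add: acc_sets_def)
qed

text \<open>Equal remainders would make \<open>E\<close> the word \<open>100w\<close>. Vertex
  \<open>1\<close> dominates the first three vertices, and with the shifted \<open>S\<close> it
  forms a rival of \<open>E\<close>. Thus the exceptional words and the words \<open>10w\<close> can
  share one target.\<close>

lemma tail_2_neq:
  assumes "acc_path n E" and "card E = card D" and "E \<inter> {..<2} = {0}"
  shows "tail 2 E \<noteq> tail 2 D"
proof
  assume eq: "tail 2 E = tail 2 D"
  obtain S where S: "S \<inter> tail 3 D = {}" "dom_path (n - 3) S" "card S = card (tail 3 D)"
    using dominating_complement by metis
  have "Suc x \<in> tail 2 E \<longleftrightarrow> Suc x \<in> tail 2 D" for x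
    using eq by simp
  then have "3 + x \<in> E \<longleftrightarrow> 3 + x \<in> D" for x
    by (simp add: tail_def numeral_eq_Suc)
  then have "S \<inter> tail 3 E = {}" using S(1) by (simp add: tail_def)
  moreover have "{Suc 0} \<inter> E = {}" using mem_prefix_iff[OF assms(3), of "Suc 0"] by simp
  moreover have "card {Suc 0} + card S = card E"
    unfolding S(3) assms(2) card_tails(2) by simp
  ultimately show False
    using not_acc_path_join[OF dom_path_small(3) S(2) n] assms(1) by blast
qed

end

section \<open>Joint count of the words \<open>10w\<close> and \<open>010w\<close>\<close>

text \<open>The words \<open>010w\<close> with accurate remainder (\<open>G\<close>) inject by
  \<open>tail 3\<close>; the exceptional ones (\<open>X\<close>) are counted together with the words
  \<open>10w\<close> (\<open>Y\<close>) by the single injection \<open>tail 2\<close>.\<close>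

lemma card_acc_10_010_le:
  assumes "2 \<le> n" and "0 < i"
  shows "card {D \<in> acc_sets n i. D \<inter> {..<2} = {0}}
      + card {D \<in> acc_sets n i. D \<inter> {..<3} = {1}}
    \<le> card (acc_sets (n - 2) (i - 1)) + (if 3 \<le> n then card (acc_sets (n - 3) (i - 1)) else 0)"
proof -
  define Y where "Y = {D \<in> acc_sets n i. D \<inter> {..<2} = {0}}"
  define Z where "Z = {D \<in> acc_sets n i. D \<inter> {..<3} = {1}}"
  define G where "G = {D \<in> Z. tail 3 D \<in> acc_sets (n - 3) (i - 1)}"
  define X where "X = Z - G"
  have fin: "finite Y" "finite Z" by (simp_all add: Y_def Z_def finite_acc_sets)
  have Y: "D \<in> acc_sets n i" "D \<inter> {..<2} = {0}" if "D \<in> Y" for D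
    using that by (simp_all add: Y_def)
  have acc_n: "acc_path n D" "card D = i" if "D \<in> acc_sets n i" for D
    using that assms by (auto simp: acc_sets_def)
  have A: "acc_path (n - 2) (tail 2 D)" "card (tail 2 D) = i - 1" if "D \<in> Y" for D
  proof -
    have D: "acc_path n D" "card D = i" "D \<inter> {..<2} = {0}" using that acc_n Y by blast+
    have "Suc 0 \<notin> D" using mem_prefix_iff[OF D(3), of "Suc 0"] by simp
    then show "acc_path (n - 2) (tail 2 D)"
      using acc_path_tail[OF D(1) assms(1) _ dom_path_small(2)] D(3) by simp
    show "card (tail 2 D) = i - 1"
      using card_split_tail[OF dom_path_finite[OF acc_path_dom[OF D(1)]], of 2] D by simp
  qed
  have "card Y + card Z
    \<le> card (acc_sets (n - 2) (i - 1)) + (if 3 \<le> n then card (acc_sets (n - 3) (i - 1)) else 0)"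
  proof (cases "3 \<le> n")
    case False
    \<comment> \<open>On two vertices the prefix \<open>{1}\<close> is the whole set, and
      \<open>{0}\<close> is its rival.\<close>
    have "\<not> acc_path n D" if "D \<inter> {..<3} = {1}" for D
    proof
      assume acc: "acc_path n D"
      have n: "n = 2" using False assms(1) by simp
      then have "D = {1}" using dom_path_subset[OF acc_path_dom[OF acc]] that by fastforce
      moreover have "dom_path 0 {}" by (simp add: dom_path_iff)
      ultimately show False
        using not_acc_path_join[OF dom_path_small(1), of n "{}" D] acc n by simp
    qed
    then have "Z = {}" using acc_n unfolding Z_def by blast
    moreover have "card Y \<le> card (acc_sets (n - 2) (i - 1))"
      using card_acc_prefix_le[OF assms(1) _ _ dom_path_small(2), of "{0}" i] by (simp add: Y_def)
    ultimately show ?thesis by simp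
  next
    case True
    have X: "exceptional n D" "card D = i" if "D \<in> X" for D
    proof -
      have D: "D \<in> acc_sets n i" "D \<inter> {..<3} = {1}" "tail 3 D \<notin> acc_sets (n - 3) (i - 1)"
        using that by (simp_all add: X_def G_def Z_def)
      show "card D = i" using acc_n(2)[OF D(1)] .
      then show "exceptional n D" using acc_n(1)[OF D(1)] True D(2,3) by unfold_locales simp_all
    qed
    have "inj_on (tail 2) (Y \<union> X)"
    proof (rule inj_onI)
      have XX: "D \<inter> {..<2} = {1}" if "D \<in> X" for D
        using exceptional.prefix_mem[OF X(1)[OF that]] by (auto simp: less_2_cases_iff)
      have neq: "tail 2 E \<noteq> tail 2 D" if "E \<in> Y" "D \<in> X" for D E
      \<comment> \<open>Within \<open>Y\<close> or within \<open>X\<close> the first two letters are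
        constant, so only a collision between the two classes has to be excluded.\<close>
      proof -
        note E = Y[OF that(1)]
        show ?thesis
          using exceptional.tail_2_neq[OF X(1)[OF that(2)] acc_n(1)[OF E(1)] _ E(2)]
            acc_n(2)[OF E(1)] X(2)[OF that(2)] by metis
      qed
      fix D E assume DE: "D \<in> Y \<union> X" "E \<in> Y \<union> X" and eq: "tail 2 D = tail 2 E"
      then consider "D \<in> Y" "E \<in> Y" | "D \<in> X" "E \<in> X"
        using neq[of D E] neq[of E D] by auto
      then have "D \<inter> {..<2} = E \<inter> {..<2}"
        by cases (simp_all add: XX Y(2))
      then show "D = E" using eq by (metis split_tail)
    qed
    moreover have "tail 2 ` (Y \<union> X) \<subseteq> acc_sets (n - 2) (i - 1)"
    proof (rule image_subsetI)
      fix D assume "D \<in> Y \<union> X"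
      then show "tail 2 D \<in> acc_sets (n - 2) (i - 1)"
        using A[of D] exceptional.acc_tail_2[OF X(1), of D] X(2)[of D]
        by (elim UnE) (simp_all add: acc_sets_def)
    qed
    ultimately have "card (Y \<union> X) \<le> card (acc_sets (n - 2) (i - 1))"
      by (rule card_inj_on_le[OF _ _ finite_acc_sets])
    moreover have "0 \<in> D" if "D \<in> Y" for D
      using mem_prefix_iff[OF Y(2)[OF that], of 0] by simp
    then have "Y \<inter> X = {}"
      using exceptional.prefix_mem(1)[OF X(1)] by blast
    ultimately have 1: "card Y + card X \<le> card (acc_sets (n - 2) (i - 1))"
      using fin by (simp add: card_Un_disjoint X_def)
    have 2: "card G \<le> card (acc_sets (n - 3) (i - 1))"
    proof (rule card_inj_on_le[OF _ _ finite_acc_sets])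
      show "inj_on (tail 3) G"
        by (intro inj_on_subset[OF inj_on_tail[of 3 "{1}"]]) (simp add: G_def Z_def subset_iff)
      show "tail 3 ` G \<subseteq> acc_sets (n - 3) (i - 1)"
        by (rule image_subsetI) (simp add: G_def)
    qed
    have "card Z = card G + card X"
      using fin card_mono[of Z G] by (simp add: X_def card_Diff_subset G_def)
    then show ?thesis using 1 2 True by simp
  qed
  then show ?thesis unfolding Y_def Z_def .
qed

section \<open>Initial runs of ones and the final count\<close>

text \<open>Here \<open>k\<close> is the first zero after the run starting at \<open>a\<close>. If a
  run of length at least \<open>2 + a\<close> were all of \<open>D\<close>, then
  \<open>n \<ge> 2 * (k - a) \<ge> k + 2\<close>, and vertex \<open>Suc k\<close> would exist
  without being dominated. The strict bound on the length gives the upper limits of the two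
  sums.\<close>

lemma dom_path_initial_run:
  assumes dom: "dom_path n D" and "2 * card D \<le> n" and "a \<in> D" and "\<And>x. x < a \<Longrightarrow> x \<notin> D" and "a \<le> 1"
  obtains k where "a < k" "D \<inter> {..<Suc k} = {a..<k}" "k - a < 2 + a \<or> k - a < card D"
proof -
  define k where "k = (LEAST x. a \<le> x \<and> x \<notin> D)"
  have "\<exists>x. a \<le> x \<and> x \<notin> D"
    using dom_path_subset[OF dom] by (metis lessThan_iff linorder_le_cases not_less subsetD)
  then have k: "a \<le> k" "k \<notin> D" unfolding k_def by (metis (mono_tags, lifting) LeastI_ex)+
  have run: "x \<in> D" if "a \<le> x" "x < k" for x
    using that not_less_Least unfolding k_def by blast
  have eq: "D \<inter> {..<Suc k} = {a..<k}"
    using k run assms(4) by (force simp: less_Suc_eq not_less)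
  have "k - a < card D" if ge: "2 + a \<le> k - a"
  proof (rule ccontr)
    assume "\<not> ?thesis"
    moreover have fin: "finite D" using dom by (rule dom_path_finite)
    moreover have sub: "{a..<k} \<subseteq> D" using eq by auto
    ultimately have "D = {a..<k}" by (metis card_atLeastLessThan card_subset_eq card_mono le_antisym not_less)
    moreover from this have "Suc k < n" using assms(2,5) ge by simp
    ultimately show False using dom_pathD[OF dom, of "Suc k"] by auto
  qed
  moreover have "a < k" using k assms(3) by (metis le_neq_implies_less)
  ultimately show ?thesis using that eq by (metis not_less)
qed

theorem theorem3p4:
  fixes n i :: int
  assumes "n \<ge> 1"
    and "\<lceil>real_of_int n / 3\<rceil> \<le> i" and "i \<le> \<lfloor>real_of_int n / 2\<rfloor>"
  shows "da_path n i \<le>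
      da_path (n - 2) (i - 1) + da_path (n - 3) (i - 1) + da_path (n - 4) (i - 2)
      + (\<Sum>k = 3..i. d_path (n - k) (i - k + 1))
      + (\<Sum>k = 5..i + 1. d_path (n - k) (i - k + 2))"
proof -
  have "real_of_int n / 3 \<le> i" using assms(2) by linarith
  then have "0 < i" using assms(1) by linarith
  then obtain I where i: "i = int I" "0 < I" by (metis zero_less_imp_eq_int)
  have "real_of_int i \<le> real_of_int n / 2" using assms(3) by linarith
  then have "2 * i \<le> n" by linarith
  moreover obtain N where n: "n = int N" using assms(1) by (metis nonneg_int_cases order.trans zero_le_one)
  ultimately have IN: "2 * I \<le> N" "2 \<le> N" using i by linarith+
  define A where "A = acc_sets N I"
  have A: "dom_path N D" "card D = I" if "D \<in> A" for D
    using that IN acc_path_dom by (auto simp: A_def acc_sets_def)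
  define A10 A010 A0110 where
    "A10 = {D \<in> A. D \<inter> {..<2} = {0}}" and "A010 = {D \<in> A. D \<inter> {..<3} = {1}}"
    and "A0110 = {D \<in> A. D \<inter> {..<4} = {1, 2}}"
  \<comment> \<open>The index \<open>k\<close> is the length of the prefix including its closing
    zero: \<open>k - 1\<close> ones and a zero in \<open>B k\<close>; a zero, \<open>k - 2\<close>
    ones and a zero in \<open>C k\<close>. The three sets above are the short cases
    \<open>B 2\<close>, \<open>C 3\<close> and \<open>C 4\<close>.\<close>
  define B where "B k = {D \<in> A. D \<inter> {..<nat k} = {0..<nat k - 1}}" for k :: int
  define C where "C k = {D \<in> A. D \<inter> {..<nat k} = {1..<nat k - 1}}" for k :: int
  have fin: "finite A" by (simp add: A_def finite_acc_sets)

  have "A \<subseteq> (A10 \<union> A010 \<union> A0110) \<union> (\<Union>k\<in>{3..i}. B k) \<union> (\<Union>k\<in>{5..i + 1}. C k)"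
  proof
    fix D assume D: "D \<in> A"
    note dom = A(1)[OF D]
    show "D \<in> (A10 \<union> A010 \<union> A0110) \<union> (\<Union>k\<in>{3..i}. B k) \<union> (\<Union>k\<in>{5..i + 1}. C k)"
    proof (cases "0 \<in> D")
      case True
      obtain k where k: "0 < k" "D \<inter> {..<Suc k} = {0..<k}" "k < 2 \<or> k < I"
        using dom_path_initial_run[OF dom, of 0] True IN A(2)[OF D] by auto
      show ?thesis
      proof (cases "k = 1")
        case True
        then have "D \<in> A10" using k D by (auto simp: A10_def numeral_2_eq_2)
        then show ?thesis by blast
      next
        case False
        \<comment> \<open>A run of length \<open>k < I\<close> has prefix length
          \<open>Suc k\<close>, at most \<open>i\<close>.\<close>
        then have "D \<in> B (int (Suc k))" "int (Suc k) \<in> {3..i}"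
          using k D i by (auto simp: B_def nat_add_distrib)
        then show ?thesis by blast
      qed
    next
      case False
      then have "1 \<in> D" using dom_pathD[OF dom, of 0] IN by auto
      then obtain k where k: "1 < k" "D \<inter> {..<Suc k} = {1..<k}" "k - 1 < 3 \<or> k - 1 < I"
        using dom_path_initial_run[OF dom, of 1] False IN A(2)[OF D] by auto
      then consider "k = 2" | "k = 3" | "4 \<le> k" by linarith
      then show ?thesis
      proof cases
        case 1
        then have "D \<in> A010" using k D by (auto simp: A010_def numeral_eq_Suc)
        then show ?thesis by blast
      next
        case 2
        then have "{1..<k} = {1, 2}" by auto
        then have "D \<in> A0110" using k D 2 by (simp add: A0110_def numeral_eq_Suc)
        then show ?thesis by blast
      next
        case 3
        \<comment> \<open>The run now starts at \<open>1\<close> and has length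
          \<open>k - 1 < I\<close>, so the limit moves up by one.\<close>
        then have "int (Suc k) \<in> {5..i + 1}"
          using k(3) 3 i by auto
        moreover have "D \<in> C (int (Suc k))"
          using k(2) D unfolding C_def nat_int by simp
        ultimately show ?thesis by blast
      qed
    qed
  qed
  then have "card A \<le> card ((A10 \<union> A010 \<union> A0110) \<union> (\<Union>k\<in>{3..i}. B k) \<union> (\<Union>k\<in>{5..i + 1}. C k))"
    using fin by (intro card_mono) (auto simp: A10_def A010_def A0110_def B_def C_def)
  also have "\<dots> \<le> card (A10 \<union> A010 \<union> A0110) + card (\<Union>k\<in>{3..i}. B k) + card (\<Union>k\<in>{5..i + 1}. C k)"
    by (meson add_le_mono1 card_Un_le order.trans)
  also have "\<dots> \<le> (card A10 + card A010 + card A0110) + (\<Sum>k = 3..i. card (B k))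
      + (\<Sum>k = 5..i + 1. card (C k))"
    by (intro add_mono card_UN_le order.trans[OF card_Un_le] card_Un_le) simp_all
  finally have cover: "card A \<le> (card A10 + card A010 + card A0110) + (\<Sum>k = 3..i. card (B k))
      + (\<Sum>k = 5..i + 1. card (C k))" .

  \<comment> \<open>For \<open>N = 2\<close> the index \<open>n - 3\<close> is negative and
    \<open>da_path\<close> takes its default value 0.\<close>
  have da3: "da_path (n - 3) (i - 1) = (if 3 \<le> N then card (acc_sets (N - 3) (I - 1)) else 0)"
    using da_path_eq_card_diff[of 3 N 1 I] i n by (auto simp: da_path_def)
  have da2: "da_path (n - 2) (i - 1) = card (acc_sets (N - 2) (I - 1))"
    using da_path_eq_card_diff[of 2 N 1 I] i n IN by simp
  have le1: "card A10 + card A010 \<le> da_path (n - 2) (i - 1) + da_path (n - 3) (i - 1)"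
    using card_acc_10_010_le[OF IN(2) i(2)] unfolding da2 da3 A10_def A010_def A_def .

  have le2: "card A0110 \<le> da_path (n - 4) (i - 2)"
  proof (cases "2 \<le> I")
    case True
    then have "4 \<le> N" using IN by linarith
    then show ?thesis
      using card_acc_prefix_le[OF _ _ _ dom_path_small(4), of N "{1, 2}" I]
        da_path_eq_card_diff[of 4 N 2 I] True n i by (simp add: A0110_def A_def numeral_2_eq_2)
  next
    case False
    \<comment> \<open>The prefix \<open>0110\<close> already contains two ones.\<close>
    have "2 \<le> I" if D: "D \<in> A0110" for D
    proof -
      have "D \<in> A" "{1, 2} \<subseteq> D" using D unfolding A0110_def by blast+
      then show ?thesis
        using card_mono[of D "{1, 2}"] A(2) dom_path_finite[OF A(1)] by fastforce
    qed
    then have "A0110 = {}" using False by blast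
    then show ?thesis by simp
  qed

  \<comment> \<open>Removing \<open>k - 1\<close> ones leaves \<open>i - k + 1\<close>; in the next
    bound, removing \<open>k - 2\<close> ones leaves \<open>i - k + 2\<close>. The ranges of
    \<open>k\<close> keep both arguments of \<open>d_path\<close> nonnegative.\<close>
  have le3: "card (B k) \<le> d_path (n - k) (i - k + 1)" if "k \<in> {3..i}" for k
  proof -
    have k: "nat k \<le> N" "0 < nat k" using that i IN by auto
    have "nat (n - k) = N - nat k" "nat (i - k + 1) = I - card {0..<nat k - 1}"
      using that i n IN by auto
    moreover have "card (B k) \<le> num_dominating (path_graph (N - nat k)) (I - card {0..<nat k - 1})"
      using k A by (intro card_prefix_le_num_dominating) (auto simp: B_def)
    moreover have "\<not> (n - k < 0 \<or> i - k + 1 < 0)" using that i n IN by auto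
    ultimately show ?thesis by (simp only: d_path_def if_False)
  qed
  have le4: "card (C k) \<le> d_path (n - k) (i - k + 2)" if "k \<in> {5..i + 1}" for k
  proof -
    have k: "nat k \<le> N" "0 < nat k" using that i IN by auto
    have "nat (n - k) = N - nat k" "nat (i - k + 2) = I - card {1..<nat k - 1}"
      using that i n IN by auto
    moreover have "card (C k) \<le> num_dominating (path_graph (N - nat k)) (I - card {1..<nat k - 1})"
      using k A by (intro card_prefix_le_num_dominating) (auto simp: C_def)
    moreover have "\<not> (n - k < 0 \<or> i - k + 2 < 0)" using that i n IN by auto
    ultimately show ?thesis by (simp only: d_path_def if_False)
  qed

  have "da_path n i = card A" by (simp add: A_def da_path_eq_card n i)
  also note cover
  also have "(card A10 + card A010 + card A0110) + (\<Sum>k = 3..i. card (B k)) + (\<Sum>k = 5..i + 1. card (C k))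
    \<le> (da_path (n - 2) (i - 1) + da_path (n - 3) (i - 1) + da_path (n - 4) (i - 2))
      + (\<Sum>k = 3..i. d_path (n - k) (i - k + 1)) + (\<Sum>k = 5..i + 1. d_path (n - k) (i - k + 2))"
    by (intro add_mono sum_mono le1 le2 le3 le4)
  finally show ?thesis .
qed

end
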